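(* Let $p(t)\in\mathbb{R}[t]$ be a finite product of polynomials each of which is either $1+t$ or of the form $(1+zt)(1+z^{-1}t)=1+ct+t^2$ with $z>0$ real, so that $c=z+z^{-1}\ge 2$ is real. Then $p$ has the mountain property: its coefficients strictly increase up to the middle and, consequently, strictly decrease after it.
   Context: Mountain property: writing $p(t)=a_0+a_1t+\dots+a_dt^d$ with $d=\deg p$, one has $a_0<a_1<\dots<a_{\lfloor d/2\rfloor}$ and $a_{\lceil d/2\rceil}>\dots>a_{d-1}>a_d$. (When $d$ is odd the two middle coefficients are equal, since $p$ is reciprocal, i.e. $a_i=a_{d-i}$.) *)

theory Defs
  imports "HOL-Computational_Algebra.Polynomial"
begin

text \<open>With \<open>d = degree p\<close>, \<open>d div 2\<close> is the floor and \<open>(d + 1) div 2\<close> the ceiling of \<open>d / 2\<close>.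
  For odd \<open>d\<close> the two middle coefficients are not compared.\<close>

definition mountain :: "real poly \<Rightarrow> bool" where
  "mountain p \<longleftrightarrow>
     (\<forall>i. i < degree p div 2 \<longrightarrow> coeff p i < coeff p (i + 1)) \<and>
     (\<forall>i. (degree p + 1) div 2 \<le> i \<and> i < degree p \<longrightarrow> coeff p i > coeff p (i + 1))"

end

theory Submission imports Defs begin

text \<open>With coefficients extended by 0 to all integer indices, a product of degree \<open>d\<close> satisfies
  \<open>a k = a (d - k)\<close> and \<open>a (k - 1) < a k\<close> for \<open>0 \<le> k \<le> d / 2\<close>; both properties are
  preserved by multiplication with \<open>1 + t\<close> and with \<open>1 + c t + t\<^sup>2\<close> for \<open>c > 1\<close>. At the new
  middle position the reflection \<open>a k = a (d - k)\<close> turns the one possibly negative difference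
  into 0 or into the negative of a difference that occurs with the factor \<open>c\<close>.\<close>

definition int_coeff :: "'a::zero poly \<Rightarrow> int \<Rightarrow> 'a" where
  "int_coeff p k = (if k < 0 then 0 else coeff p (nat k))"

lemma int_coeff_of_nat [simp]: "int_coeff p (int n) = coeff p n"
  by (simp add: int_coeff_def)

lemma int_coeff_neg [simp]: "k < 0 \<Longrightarrow> int_coeff p k = 0"
  by (simp add: int_coeff_def)

lemma int_coeff_add [simp]: "int_coeff (p + q) k = int_coeff p k + int_coeff q k"
  for p q :: "'a::comm_monoid_add poly"
  by (simp add: int_coeff_def)

lemma int_coeff_smult [simp]: "int_coeff (smult c p) k = c * int_coeff p k"
  for p :: "'a::comm_semiring_0 poly"
  by (simp add: int_coeff_def)

lemma int_coeff_pCons_0 [simp]: "int_coeff (pCons 0 p) k = int_coeff p (k - 1)"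
  by (auto simp: int_coeff_def coeff_pCons nat_diff_distrib split: nat.split)

text \<open>For \<open>0 \<le> d\<close> the instance \<open>k = 0\<close> makes \<open>a 0\<close>
  positive, since \<open>a (- 1)\<close> vanishes; the reflection carries the vanishing below 0 to
  the indices above \<open>d\<close>.\<close>

definition strict_peak :: "int \<Rightarrow> (int \<Rightarrow> 'a::linordered_idom) \<Rightarrow> bool" where
  "strict_peak d a \<longleftrightarrow> (\<forall>k<0. a k = 0) \<and> (\<forall>k. a (d - k) = a k) \<and>
     (\<forall>k. 0 \<le> k \<and> 2 * k \<le> d \<longrightarrow> a (k - 1) < a k)"

lemma strict_peakD:
  assumes "strict_peak d a"
  shows "k < 0 \<Longrightarrow> a k = 0" "a (d - k) = a k"
    and "0 \<le> k \<Longrightarrow> 2 * k \<le> d \<Longrightarrow> a (k - 1) < a k"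
  using assms by (auto simp: strict_peak_def)

text \<open>Shifted indices such as \<open>k - 2\<close> may be negative; there both sides are 0, so
  weak monotonicity survives without a lower bound on \<open>k\<close>.\<close>

lemma strict_peak_le:
  assumes "strict_peak d a" "2 * k \<le> d"
  shows "a (k - 1) \<le> a k"
  using strict_peakD[OF assms(1), of k] strict_peakD(1)[OF assms(1), of "k - 1"] assms(2)
  by (cases "k < 0") auto

lemma strict_peak_linear:
  assumes a: "strict_peak d a" and "0 \<le> d"
  shows "strict_peak (d + 1) (\<lambda>k. a k + a (k - 1))"
  unfolding strict_peak_def
proof (intro conjI allI impI)
  fix k :: int
  show "a k + a (k - 1) = 0" if "k < 0"
    using that by (simp add: strict_peakD(1)[OF a])
  show "a (d + 1 - k) + a (d + 1 - k - 1) = a k + a (k - 1)"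
    using strict_peakD(2)[OF a, of "k - 1"] strict_peakD(2)[OF a, of k]
    by (simp add: algebra_simps)
  assume k: "0 \<le> k \<and> 2 * k \<le> d + 1"
  \<comment> \<open>The difference of the new sequence at \<open>k\<close> telescopes to
    \<open>a k - a (k - 2)\<close>.\<close>
  have "a (k - 2) < a k"
  proof (cases "2 * k \<le> d")
    case True
    then show ?thesis
      using strict_peakD(3)[OF a, of k] strict_peak_le[OF a, of "k - 1"] k by simp
  next
    case False
    \<comment> \<open>Only \<open>2 * k = d + 1\<close> is left, and \<open>0 \<le> d\<close> then
      forces \<open>1 \<le> k\<close>.\<close>
    then have "d - k = k - 1" "0 \<le> k - 1" "2 * (k - 1) \<le> d"
      using k \<open>0 \<le> d\<close> by presburger+
    then show ?thesis
      using strict_peakD(2)[OF a, of k] strict_peakD(3)[OF a, of "k - 1"] by simp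
  qed
  then show "a (k - 1) + a (k - 1 - 1) < a k + a (k - 1)"
    by simp
qed

lemma strict_peak_quadratic:
  assumes a: "strict_peak d a" and "0 \<le> d" and c: "1 < c"
  shows "strict_peak (d + 2) (\<lambda>k. a k + c * a (k - 1) + a (k - 2))"
  unfolding strict_peak_def
proof (intro conjI allI impI)
  fix k :: int
  show "a k + c * a (k - 1) + a (k - 2) = 0" if "k < 0"
    using that by (simp add: strict_peakD(1)[OF a])
  show "a (d + 2 - k) + c * a (d + 2 - k - 1) + a (d + 2 - k - 2) =
      a k + c * a (k - 1) + a (k - 2)"
    using strict_peakD(2)[OF a, of "k - 1"] strict_peakD(2)[OF a, of k]
      strict_peakD(2)[OF a, of "k - 2"]
    by (simp add: algebra_simps)
  assume k: "0 \<le> k \<and> 2 * k \<le> d + 2"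
  have le: "a (k - 2) \<le> a (k - 1)" "a (k - 3) \<le> a (k - 2)"
    using strict_peak_le[OF a, of "k - 1"] strict_peak_le[OF a, of "k - 2"] k by simp_all
  have mono: "a (k - 1) - a (k - 2) \<le> c * (a (k - 1) - a (k - 2))"
    using mult_right_mono[of 1 c "a (k - 1) - a (k - 2)"] le c by simp
  have "0 < (a k - a (k - 1)) + c * (a (k - 1) - a (k - 2)) + (a (k - 2) - a (k - 3))"
  proof -
    \<comment> \<open>The last two cases are \<open>2 * k = d + 1\<close> and
      \<open>2 * k = d + 2\<close>. In both, \<open>k - 1\<close> lies in the strictly increasing
      range, so the middle difference is positive.\<close>
    consider "2 * k \<le> d" | "d - k = k - 1" "1 \<le> k" | "d - k = k - 2" "1 \<le> k"
      using k \<open>0 \<le> d\<close> by linarith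
    then show ?thesis
    proof cases
      case 1
      then show ?thesis
        using strict_peakD(3)[OF a, of k] k le mono by linarith
    next
      \<comment> \<open>The first difference is 0 by reflection; the middle one supplies
        strictness.\<close>
      case 2
      then have "a k = a (k - 1)" "a (k - 2) < a (k - 1)"
        using strict_peakD(2)[OF a, of k] strict_peakD(3)[OF a, of "k - 1"] by simp_all
      then show ?thesis
        using le mono by linarith
    next
      \<comment> \<open>The first difference is now the negative of the middle one, which leaves the
        factor \<open>c - 1\<close> on a positive number: here \<open>1 < c\<close> must be
        strict.\<close>
      case 3
      then have "a k = a (k - 2)" and less: "a (k - 2) < a (k - 1)"
        using strict_peakD(2)[OF a, of k] strict_peakD(3)[OF a, of "k - 1"] by simp_all
      moreover have "a (k - 1) - a (k - 2) < c * (a (k - 1) - a (k - 2))"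
        using mult_strict_right_mono[of 1 c "a (k - 1) - a (k - 2)"] less c by simp
      ultimately show ?thesis
        using le by linarith
    qed
  qed
  then show "a (k - 1) + c * a (k - 1 - 1) + a (k - 1 - 2) < a k + c * a (k - 1) + a (k - 2)"
    by (simp add: algebra_simps)
qed

lemma mountain_if_strict_peak:
  assumes a: "strict_peak (int (degree p)) (int_coeff p)"
  shows "mountain p"
  unfolding mountain_def
proof (intro conjI allI impI)
  fix i
  show "coeff p i < coeff p (i + 1)" if "i < degree p div 2"
    using strict_peakD(3)[OF a, of "int (i + 1)"] int_coeff_of_nat[of p "i + 1"] that by simp
  assume i: "(degree p + 1) div 2 \<le> i \<and> i < degree p"
  \<comment> \<open>Reflection sends the descent from \<open>i\<close> to \<open>i + 1\<close> to
    the ascent from \<open>j - 1\<close> to \<open>j\<close>, where \<open>j = degree p - i\<close>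
    is at most half the degree.\<close>
  then have "int (degree p) - int i = int (degree p - i)"
    "int (degree p) - int (i + 1) = int (degree p - i) - 1" "2 * (degree p - i) \<le> degree p"
    by linarith+
  then show "coeff p (i + 1) < coeff p i"
    using strict_peakD(2)[OF a, of "int i"] strict_peakD(2)[OF a, of "int (i + 1)"]
      strict_peakD(3)[OF a, of "int (degree p - i)"]
    by (simp del: of_nat_Suc of_nat_add)
qed

text \<open>One of \<open>z\<close> and \<open>inverse z\<close> is at least 1 and the other is
  positive.\<close>

lemma add_inverse_gt_1:
  fixes z :: "'a::linordered_field"
  assumes "0 < z"
  shows "1 < z + inverse z"
proof (cases "1 < z")
  case True
  then show ?thesis
    using assms add_strict_mono[of 1 z 0 "inverse z"] by simp
next
  case False
  then have "1 \<le> inverse z"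
    using assms by (simp add: one_le_inverse)
  then show ?thesis
    using assms by (simp add: add_strict_increasing)
qed

theorem proposition3:
  fixes p :: "real poly" and qs :: "real poly list"
  assumes "\<forall>q\<in>set qs. q = [:1, 1:] \<or> (\<exists>z::real. z > 0 \<and> q = [:1, z:] * [:1, inverse z:])"
    and "p = prod_list qs"
  shows "mountain p"
proof -
  \<comment> \<open>Nonzeroness is carried through the induction so that degrees add under
    multiplication.\<close>
  have "prod_list qs \<noteq> 0 \<and> strict_peak (int (degree (prod_list qs))) (int_coeff (prod_list qs))"
    using assms(1)
  proof (induction qs)
    case Nil
    show ?case
      by (auto simp: strict_peak_def int_coeff_def)
  next
    case (Cons q qs)
    define r where "r = prod_list qs"
    have r: "r \<noteq> 0" and peak: "strict_peak (int (degree r)) (int_coeff r)"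
      using Cons by (auto simp: r_def)
    consider "q = [:1, 1:]" | z where "z > 0" "q = [:1, z:] * [:1, inverse z:]"
      using Cons.prems by auto
    then have "q * r \<noteq> 0 \<and> strict_peak (int (degree (q * r))) (int_coeff (q * r))"
    proof cases
      case 1
      then have "int_coeff (q * r) = (\<lambda>k. int_coeff r k + int_coeff r (k - 1))"
        by (simp add: fun_eq_iff)
      moreover have "int (degree (q * r)) = int (degree r) + 1"
        using 1 r by (subst degree_mult_eq) auto
      ultimately show ?thesis
        using strict_peak_linear[OF peak] 1 r by (simp del: mult_pCons_left)
    next
      case 2
      define c where "c = z + inverse z"
      have q: "q = [:1, c, 1:]"
        using 2 by (simp add: c_def)
      have "int_coeff (q * r) = (\<lambda>k. int_coeff r k + c * int_coeff r (k - 1) + int_coeff r (k - 2))"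
        by (simp add: q fun_eq_iff)
      moreover have "int (degree (q * r)) = int (degree r) + 2"
        using r by (subst degree_mult_eq) (auto simp: q)
      moreover have "q * r \<noteq> 0"
        using r by (simp add: q del: mult_pCons_left)
      ultimately show ?thesis
        using strict_peak_quadratic[OF peak, of c] add_inverse_gt_1[OF 2(1)] by (simp add: c_def)
    qed
    then show ?case
      by (simp add: r_def)
  qed
  then show ?thesis
    unfolding assms(2) by (blast intro: mountain_if_strict_peak)
qed

end
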